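(* Consider any instance of the Online Budgeted Repeated Matching (OBRM) problem (defined in the context) in which every edge weight satisfies $w(i,j)\le C_i$, the instance being fixed in advance independently of the algorithm's random coin flips (oblivious adversary). Let $A(T)$ be the allocation output by the randomized algorithm RANDOMONLINEGREEDY (defined in the context) and $\mathrm{OPT}$ the maximum total weight of a feasible set of edges for the instance. Then $\mathbb{E}[W(A(T))]\ge \tfrac16\,\mathrm{OPT}$, i.e. RANDOMONLINEGREEDY is $6$-competitive.
   Context: OBRM problem: there is a set $I=\{1,\dots,n\}$ of servers, server $i$ having capacity $C_i>0$. At each time step $t\in\{1,\dots,T\}$ a set of jobs $J(t)$ and a set $E(t)$ of edges between servers $I$ and jobs $J(t)$ are revealed, forming the bipartite graph $G(t)=(I\cup J(t),E(t))$; each edge $e=(i,j)$ has a nonnegative weight $w(e)=w(i,j)$ (a job may have different weights on different servers). For a set of edges $F$, $W(F)=\sum_{e\in F}w(e)$. A set of edges $F$ is feasible if (i) for each $t$ the edges of $F$ in $E(t)$ form a matching, and (ii) for each server $i$ the total weight of edges of $F$ incident to $i$ is at most $C_i$. Choices must be made online and irrevocably. A randomized algorithm is $\gamma$-competitive if on every instance its expected total weight is at least $1/\gamma$ times the optimal (offline) feasible weight. Subroutine GREEDY$(G,S)$: given a weighted bipartite graph $G$ and a set $S$ of servers, start with $M=\emptyset$, scan the edges of $G$ in non-increasing order of weight, and add edge $(i,j)$ to $M$ if $i\in S$ and $M\cup\{(i,j)\}$ is still a matching. Return $M$. RANDOMONLINEGREEDY: before the input, for each server $i$ flip an independent fair coin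 $v_i\in\{0,1\}$. Initially $S=I$ and $A_i(0)=B_i(0)=\emptyset$ for all $i$. For $t=1,\dots,T$: set $M(t)=$GREEDY$(G(t),S)$; for each $e=(i,j)\in M(t)$: set $B_i(t)=B_i(t-1)\cup\{e\}$; if $W(B_i(t))>\tfrac12 C_i$ remove $i$ from $S$; if ($v_i=1$ and $w(i,j)>\tfrac12C_i$) or ($v_i=0$ and $w(i,j)\le \tfrac12 C_i$) then set $A_i(t)=A_i(t-1)\cup\{e\}$. (Sets not updated at step $t$ are carried over unchanged.) The output is $A(T)=\bigcup_i A_i(T)$. *)

theory Defs
  imports "HOL-Probability.Product_PMF"
begin

text \<open>
  Edges within one time step are pairs (server, job). Sets of edges spanning several steps consist
  of pairs (time, edge), so that edges revealed at different steps are always different edges,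
  whatever names the jobs carry. Accordingly, the weight function takes the time step as an
  argument.
\<close>

type_synonym 'j edge = "nat \<times> 'j"
type_synonym 'j timed_edge = "nat \<times> 'j edge"

definition obrm_instance ::
  "nat \<Rightarrow> (nat \<Rightarrow> real) \<Rightarrow> nat \<Rightarrow> (nat \<Rightarrow> 'j set) \<Rightarrow> (nat \<Rightarrow> 'j edge set) \<Rightarrow>
   (nat \<Rightarrow> 'j edge \<Rightarrow> real) \<Rightarrow> bool" where
  "obrm_instance n C T J E w \<longleftrightarrow>
     (\<forall>i\<in>{1..n}. 0 < C i) \<and>
     (\<forall>t\<in>{1..T}. finite (J t) \<and> E t \<subseteq> {1..n} \<times> J t \<and> (\<forall>e\<in>E t. 0 \<le> w t e))"

definition matching :: "'j edge set \<Rightarrow> bool" where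
  "matching M \<longleftrightarrow> (\<forall>e\<in>M. \<forall>e'\<in>M. e \<noteq> e' \<longrightarrow> fst e \<noteq> fst e' \<and> snd e \<noteq> snd e')"

definition weight :: "(nat \<Rightarrow> 'j edge \<Rightarrow> real) \<Rightarrow> 'j timed_edge set \<Rightarrow> real" where
  "weight w F = (\<Sum>(t, e)\<in>F. w t e)"

definition feasible ::
  "nat \<Rightarrow> (nat \<Rightarrow> real) \<Rightarrow> nat \<Rightarrow> (nat \<Rightarrow> 'j edge set) \<Rightarrow> (nat \<Rightarrow> 'j edge \<Rightarrow> real) \<Rightarrow>
   'j timed_edge set \<Rightarrow> bool" where
  "feasible n C T E w F \<longleftrightarrow>
     F \<subseteq> Sigma {1..T} E \<and>
     (\<forall>t\<in>{1..T}. matching {e. (t, e) \<in> F}) \<and>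
     (\<forall>i\<in>{1..n}. weight w {(t, e). (t, e) \<in> F \<and> fst e = i} \<le> C i)"

text \<open>
  In an instance there are only finitely many feasible sets, and the empty set is one of them, so
  the maximum is attained.
\<close>

definition OPT ::
  "nat \<Rightarrow> (nat \<Rightarrow> real) \<Rightarrow> nat \<Rightarrow> (nat \<Rightarrow> 'j edge set) \<Rightarrow> (nat \<Rightarrow> 'j edge \<Rightarrow> real) \<Rightarrow> real" where
  "OPT n C T E w = Max {weight w F |F. feasible n C T E w F}"

text \<open>
  A scan order lists the edges of one graph by non-increasing weight; ties may be broken in any way.
\<close>

definition scan_order :: "('j edge \<Rightarrow> real) \<Rightarrow> 'j edge set \<Rightarrow> 'j edge list \<Rightarrow> bool" where
  "scan_order u F es \<longleftrightarrow> distinct es \<and> set es = F \<and> sorted_wrt (\<lambda>e e'. u e \<ge> u e') es"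

text \<open>The matching is returned as a list, in the order in which its edges are selected.\<close>

definition greedy :: "'j edge list \<Rightarrow> nat set \<Rightarrow> 'j edge list" where
  "greedy es S =
     fold (\<lambda>e M. if fst e \<in> S \<and> matching (insert e (set M)) then M @ [e] else M) es []"

text \<open>
  The fields are \<open>S\<close>, the family \<open>B\<^sub>i\<close> and the family \<open>A\<^sub>i\<close>. The coin of server \<open>i\<close> is
  \<open>v i\<close>, where \<open>True\<close> stands for 1 and \<open>False\<close> for 0.
\<close>

record 'j rog_state =
  S_of :: "nat set"
  B_of :: "nat \<Rightarrow> 'j timed_edge set"
  A_of :: "nat \<Rightarrow> 'j timed_edge set"

definition rog_edge ::
  "(nat \<Rightarrow> real) \<Rightarrow> (nat \<Rightarrow> 'j edge \<Rightarrow> real) \<Rightarrow> (nat \<Rightarrow> bool) \<Rightarrow> nat \<Rightarrow> 'j edge \<Rightarrow>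
   'j rog_state \<Rightarrow> 'j rog_state" where
  "rog_edge C w v t e s =
     (let i = fst e;
          Bi = B_of s i \<union> {(t, e)}
      in \<lparr> S_of = (if weight w Bi > C i / 2 then S_of s - {i} else S_of s),
           B_of = (B_of s)(i := Bi),
           A_of = (if (v i \<and> w t e > C i / 2) \<or> (\<not> v i \<and> w t e \<le> C i / 2)
                   then (A_of s)(i := A_of s i \<union> {(t, e)}) else A_of s) \<rparr>)"

text \<open>
  The edges of step \<open>t\<close> are scanned in the order \<open>scan t\<close>. For a fixed instance the evolution of
  \<open>S\<close> does not depend on the coins, so letting the order depend on \<open>t\<close> alone covers every
  tie-breaking rule that is oblivious to the coins.
\<close>

primrec rog_run ::
  "nat \<Rightarrow> (nat \<Rightarrow> real) \<Rightarrow> (nat \<Rightarrow> 'j edge \<Rightarrow> real) \<Rightarrow> (nat \<Rightarrow> 'j edge list) \<Rightarrow>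
   (nat \<Rightarrow> bool) \<Rightarrow> nat \<Rightarrow> 'j rog_state" where
  "rog_run n C w scan v 0 = \<lparr> S_of = {1..n}, B_of = (\<lambda>_. {}), A_of = (\<lambda>_. {}) \<rparr>"
| "rog_run n C w scan v (Suc t) =
     (let s = rog_run n C w scan v t
      in fold (rog_edge C w v (Suc t)) (greedy (scan (Suc t)) (S_of s)) s)"

definition rog_output ::
  "nat \<Rightarrow> (nat \<Rightarrow> real) \<Rightarrow> nat \<Rightarrow> (nat \<Rightarrow> 'j edge \<Rightarrow> real) \<Rightarrow> (nat \<Rightarrow> 'j edge list) \<Rightarrow>
   (nat \<Rightarrow> bool) \<Rightarrow> 'j timed_edge set" where
  "rog_output n C T w scan v = (\<Union>i\<in>{1..n}. A_of (rog_run n C w scan v T) i)"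

definition coins :: "nat \<Rightarrow> (nat \<Rightarrow> bool) pmf" where
  "coins n = Pi_pmf {1..n} False (\<lambda>_. bernoulli_pmf (1/2))"

end

theory Submission
  imports Defs
begin

text \<open>
  Let \<open>B\<close> be the union of the final sets \<open>B\<^sub>i\<close>. It does not depend on the coins, and each of its
  edges is put into the output by exactly one of the two values of its server's coin, so the
  expected output weight is \<open>W(B) / 2\<close>. It remains to see that a feasible \<open>F\<close> has weight at most
  \<open>3 W(B)\<close>. A server \<open>i\<close> that is removed from \<open>S\<close> has \<open>W(F\<^sub>i) \<le> C\<^sub>i < 2 W(B\<^sub>i)\<close>. An edge of \<open>F\<close> at a
  server that is never removed is dominated by a greedy edge of the same step sharing its server or
  its job. As \<open>F\<close> is a matching in every step, a greedy edge is charged at most once through its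
  server (and not at all if that server is removed) and at most once through its job.
\<close>

section \<open>Charging a feasible set to the greedy edges\<close>

text \<open>Each \<open>x\<close> is charged to some \<open>y\<close> with the same key. As
  \<open>k\<close> is injective on \<open>F\<close>, no two elements of \<open>F\<close> share a
  target, and the targets not hit only add nonnegative terms.\<close>

lemma sum_le_sum_charging:
  fixes f :: "'a \<Rightarrow> real"
  assumes "finite B" "inj_on k F"
    and charge: "\<And>x. x \<in> F \<Longrightarrow> \<exists>y\<in>B. k y = k x \<and> f x \<le> f y"
    and nonneg: "\<And>y. y \<in> B \<Longrightarrow> 0 \<le> f y"
  shows "sum f F \<le> sum f B"
proof -
  obtain g where g: "\<And>x. x \<in> F \<Longrightarrow> g x \<in> B \<and> k (g x) = k x \<and> f x \<le> f (g x)"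
    using charge by metis
  have inj: "inj_on g F"
    using g \<open>inj_on k F\<close> unfolding inj_on_def by metis
  have "sum f F \<le> sum (f \<circ> g) F"
    using g by (auto intro: sum_mono)
  also have "\<dots> = sum f (g ` F)"
    using inj by (simp add: sum.reindex)
  also have "\<dots> \<le> sum f B"
    using g nonneg \<open>finite B\<close> by (intro sum_mono2) auto
  finally show ?thesis .
qed

text \<open>The combinatorial core, separated from the algorithm: \<open>B\<close> stands for all
  greedily selected edges and \<open>R\<close> for the servers removed from
  \<open>S\<close>.\<close>

lemma feasible_weight_le_triple:
  fixes w :: "nat \<Rightarrow> 'j edge \<Rightarrow> real"
  assumes F: "feasible n C T E w F" and finF: "finite F"
    and E: "\<And>t. t \<in> {1..T} \<Longrightarrow> E t \<subseteq> {1..n} \<times> UNIV"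
    and finB: "finite B"
    and nonneg: "\<And>t e. (t, e) \<in> B \<Longrightarrow> 0 \<le> w t e"
    and R: "R \<subseteq> {1..n}"
    and heavy: "\<And>i. i \<in> R \<Longrightarrow> C i \<le> 2 * weight w {x \<in> B. fst (snd x) = i}"
    and blocked: "\<And>t e. (t, e) \<in> F \<Longrightarrow> fst e \<notin> R \<Longrightarrow>
        \<exists>e'. (t, e') \<in> B \<and> w t e \<le> w t e' \<and> (fst e' = fst e \<or> snd e' = snd e)"
  shows "weight w F \<le> 3 * weight w B"
proof -
  define f where "f = (\<lambda>(t, e). w t e)"
  define srv where "srv x = fst (snd x)" for x :: "'j timed_edge"
  define FR where "FR = {x \<in> F. srv x \<in> R}"
  define BR where "BR = {x \<in> B. srv x \<in> R}"
  \<comment> \<open>Restricting \<open>y\<close> to \<open>B - BR\<close> keeps the edges of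
    \<open>BR\<close>, which already pay twice for \<open>FR\<close>, from being charged again
    through their server. The rest, \<open>FJ\<close>, is charged through jobs.\<close>
  define FS where "FS = {x \<in> F - FR. \<exists>y\<in>B - BR. (fst y, srv y) = (fst x, srv x) \<and> f x \<le> f y}"
  define FJ where "FJ = F - FR - FS"
  have W: "weight w X = sum f X" for X
    by (simp add: weight_def f_def)
  have finR: "finite R"
    using R finite_subset by blast
  have f0: "0 \<le> f y" if "y \<in> B" for y
    using nonneg that by (cases y) (auto simp: f_def)
  \<comment> \<open>Since \<open>F\<close> is a matching in every step, the time together with
    either the server or the job determines an edge of \<open>F\<close>.\<close>
  have inj: "inj_on (\<lambda>x. (fst x, srv x)) F" "inj_on (\<lambda>x. (fst x, snd (snd x))) F"
    using F unfolding feasible_def matching_def srv_def by (fastforce simp: inj_on_def)+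
  have "sum f FR = (\<Sum>i\<in>R. sum f {x \<in> FR. srv x = i})"
    using finF finR by (intro sum.group[symmetric]) (auto simp: FR_def)
  also have "\<dots> \<le> (\<Sum>i\<in>R. 2 * sum f {x \<in> BR. srv x = i})"
  proof (rule sum_mono)
    fix i assume i: "i \<in> R"
    have "{x \<in> FR. srv x = i} = {(t, e). (t, e) \<in> F \<and> fst e = i}"
      using i by (auto simp: FR_def srv_def)
    moreover have "{x \<in> BR. srv x = i} = {x \<in> B. fst (snd x) = i}"
      using i by (auto simp: BR_def srv_def)
    ultimately show "sum f {x \<in> FR. srv x = i} \<le> 2 * sum f {x \<in> BR. srv x = i}"
      using i R F heavy[OF i] unfolding feasible_def W[symmetric] by force
  qed
  also have "\<dots> = 2 * (\<Sum>i\<in>R. sum f {x \<in> BR. srv x = i})"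
    by (simp add: sum_distrib_left)
  also have "(\<Sum>i\<in>R. sum f {x \<in> BR. srv x = i}) = sum f BR"
    using finB finR by (intro sum.group) (auto simp: BR_def)
  finally have 1: "sum f FR \<le> 2 * sum f BR" .
  have 2: "sum f FS \<le> sum f (B - BR)"
    by (rule sum_le_sum_charging[where k = "\<lambda>x. (fst x, srv x)"])
      (use finB f0 in \<open>auto simp: FS_def intro: inj_on_subset[OF inj(1)]\<close>)
  have 3: "sum f FJ \<le> sum f B"
  proof (rule sum_le_sum_charging[where k = "\<lambda>x. (fst x, snd (snd x))"])
    show "inj_on (\<lambda>x. (fst x, snd (snd x))) FJ"
      by (rule inj_on_subset[OF inj(2)]) (auto simp: FJ_def)
    fix x assume x: "x \<in> FJ"
    obtain t e where te: "x = (t, e)" by (cases x)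
    have "fst e \<notin> R" "(t, e) \<in> F"
      using x by (auto simp: FJ_def FR_def te srv_def)
    from blocked[OF this(2,1)] obtain e' where e': "(t, e') \<in> B" "w t e \<le> w t e'"
      "fst e' = fst e \<or> snd e' = snd e" by blast
    \<comment> \<open>A blocking edge at the same server would lie outside \<open>BR\<close>,
      because \<open>fst e\<close> is not in \<open>R\<close>, and would put \<open>x\<close> into
      \<open>FS\<close>. So the two edges share the job.\<close>
    have "fst e' \<noteq> fst e"
    proof
      assume eq: "fst e' = fst e"
      then have "(t, e') \<in> B - BR"
        using e' \<open>fst e \<notin> R\<close> by (auto simp: BR_def srv_def)
      then have "x \<in> FS"
        using x e' eq unfolding FS_def FJ_def te
        by (auto simp: srv_def f_def intro!: bexI[of _ "(t, e')"])
      with x show False by (simp add: FJ_def)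
    qed
    then show "\<exists>y\<in>B. (fst y, snd (snd y)) = (fst x, snd (snd x)) \<and> f x \<le> f y"
      using e' by (intro bexI[of _ "(t, e')"]) (auto simp: te f_def)
  qed (use finB f0 in auto)
  have "sum f F = sum f FR + sum f FS + sum f FJ"
  proof -
    have "sum f F = sum f FR + sum f (F - FR)"
      using finF by (subst sum.subset_diff[of FR F]) (auto simp: FR_def)
    also have "sum f (F - FR) = sum f FS + sum f FJ"
      using finF unfolding FJ_def
      by (subst sum.subset_diff[of FS "F - FR"]) (auto simp: FS_def)
    finally show ?thesis by simp
  qed
  moreover have "sum f B = sum f BR + sum f (B - BR)"
    using finB by (subst sum.subset_diff[of BR B]) (auto simp: BR_def)
  moreover have "0 \<le> sum f (B - BR)"
    using f0 by (intro sum_nonneg) auto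
  \<comment> \<open>The charges add up to three times \<open>BR\<close> and twice
    \<open>B - BR\<close>.\<close>
  ultimately show ?thesis
    using 1 2 3 by (simp add: W)
qed

section \<open>The greedy matching\<close>

lemma set_greedy_subset: "set (greedy es S) \<subseteq> set es"
proof -
  have "set (fold (\<lambda>e M. if fst e \<in> S \<and> matching (insert e (set M)) then M @ [e] else M) es M)
      \<subseteq> set M \<union> set es" for M
  proof (induction es arbitrary: M)
    case (Cons a es)
    show ?case
      using Cons[of M] Cons[of "M @ [a]"] by auto
  qed simp
  from this[of "[]"] show ?thesis
    by (simp add: greedy_def)
qed

text \<open>Either \<open>e\<close> is selected and is its own witness, or it conflicts with an edge
  selected before it, which is at least as heavy by the scan order.\<close>

lemma greedy_blocks:
  assumes "sorted_wrt (\<lambda>e e'. u e \<ge> u e') es" "e \<in> set es" "fst e \<in> S"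
  shows "\<exists>e'\<in>set (greedy es S). u e \<le> (u e' :: real) \<and> (fst e' = fst e \<or> snd e' = snd e)"
proof -
  define step where
    "step = (\<lambda>(e :: nat \<times> 'a) M. if fst e \<in> S \<and> matching (insert e (set M)) then M @ [e] else M)"
  have mono: "set M \<subseteq> set (fold step es M)" for es M
  proof (induction es arbitrary: M)
    case (Cons a es)
    have "set M \<subseteq> set (step a M)"
      by (auto simp: step_def)
    with Cons[of "step a M"] show ?case by auto
  qed simp
  \<comment> \<open>Generalised to any accumulator \<open>M\<close> that is a matching and whose
    edges are at least as heavy as all those still to be scanned; both properties survive a
    step.\<close>
  have "\<exists>e'\<in>set (fold step es M). u e \<le> u e' \<and> (fst e' = fst e \<or> snd e' = snd e)"
    if "matching (set M)" "\<forall>a\<in>set M. \<forall>b\<in>set es. u b \<le> u a" for M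
    using assms(1,2) that
  proof (induction es arbitrary: M)
    case (Cons a es)
    have M: "matching (set (step a M))"
      using Cons.prems by (auto simp: step_def)
    show ?case
    proof (cases "e \<in> set es")
      case True
      have "\<forall>c\<in>set (step a M). \<forall>b\<in>set es. u b \<le> u c"
        using Cons.prems by (auto simp: step_def)
      with Cons True M show ?thesis by simp
    next
      case False
      then have e: "e = a" using Cons.prems by simp
      have "\<exists>e'\<in>set (step a M). u e \<le> u e' \<and> (fst e' = fst e \<or> snd e' = snd e)"
      proof (cases "matching (insert a (set M))")
        case True
        then show ?thesis using e assms(3) by (auto simp: step_def)
      next
        case False
        then obtain e' where "e' \<in> set M" "fst e' = fst a \<or> snd e' = snd a"
          using Cons.prems(3) unfolding matching_def by (metis insert_iff)
        then show ?thesis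
          using False e Cons.prems(4) by (auto simp: step_def)
      qed
      then show ?thesis using mono[of "step a M" es] by auto
    qed
  qed simp
  from this[of "[]"] show ?thesis
    by (simp add: greedy_def step_def matching_def)
qed

section \<open>Invariants of the run\<close>

text \<open>One equivalence merges the heavy and the light case of the acceptance rule, so it is
  visible that exactly one coin value accepts a given edge.\<close>

definition keeps ::
  "(nat \<Rightarrow> real) \<Rightarrow> (nat \<Rightarrow> 'j edge \<Rightarrow> real) \<Rightarrow> (nat \<Rightarrow> bool) \<Rightarrow> 'j timed_edge \<Rightarrow> bool" where
  "keeps C w v = (\<lambda>(t, e). v (fst e) \<longleftrightarrow> w t e > C (fst e) / 2)"

lemma B_of_fold_rog_edge:
  "B_of (fold (rog_edge C w v t) Ms s) i = B_of s i \<union> Pair t ` {e \<in> set Ms. fst e = i}"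
  by (induction Ms arbitrary: s) (auto simp: rog_edge_def Let_def)

lemma A_of_fold_rog_edge:
  "A_of (fold (rog_edge C w v t) Ms s) i =
     A_of s i \<union> Pair t ` {e \<in> set Ms. fst e = i \<and> keeps C w v (t, e)}"
  by (induction Ms arbitrary: s) (auto simp: rog_edge_def Let_def keeps_def)

lemma S_of_fold_rog_edge_subset: "S_of (fold (rog_edge C w v t) Ms s) \<subseteq> S_of s"
proof (induction Ms arbitrary: s)
  case (Cons e Ms)
  have "S_of (rog_edge C w v t e s) \<subseteq> S_of s"
    by (auto simp: rog_edge_def Let_def)
  with Cons[of "rog_edge C w v t e s"] show ?case by auto
qed simp

lemma weight_mono:
  assumes "finite Y" "X \<subseteq> Y" "\<And>t e. (t, e) \<in> Y \<Longrightarrow> 0 \<le> w t e"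
  shows "weight w X \<le> weight w Y"
  unfolding weight_def using assms by (intro sum_mono2) auto

text \<open>The bound holds at the moment of removal, and afterwards the set of \<open>i\<close>
  only gains edges of nonnegative weight.\<close>

lemma removed_fold_rog_edge:
  assumes "i \<in> S_of s" "i \<notin> S_of (fold (rog_edge C w v t) Ms s)"
    and "finite (B_of s i)" "\<And>t e. (t, e) \<in> B_of s i \<Longrightarrow> 0 \<le> w t e"
    and "\<And>e. e \<in> set Ms \<Longrightarrow> 0 \<le> w t e"
  shows "C i / 2 < weight w (B_of (fold (rog_edge C w v t) Ms s) i)"
  using assms
proof (induction Ms arbitrary: s)
  case (Cons e Ms)
  let ?s = "rog_edge C w v t e s"
  have fin: "finite (B_of ?s i)" and nn: "\<And>t e. (t, e) \<in> B_of ?s i \<Longrightarrow> 0 \<le> w t e"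
    using Cons.prems by (auto simp: rog_edge_def Let_def split: if_splits)
  show ?case
  proof (cases "i \<in> S_of ?s")
    case True
    then show ?thesis using Cons.IH[of ?s] Cons.prems fin nn by simp
  next
    case False
    then have "C i / 2 < weight w (B_of ?s i)"
      using Cons.prems(1) by (auto simp: rog_edge_def Let_def split: if_splits)
    also have "\<dots> \<le> weight w (B_of (fold (rog_edge C w v t) Ms ?s) i)"
      by (rule weight_mono) (use fin nn Cons.prems in \<open>auto simp: B_of_fold_rog_edge\<close>)
    finally show ?thesis by simp
  qed
qed simp

text \<open>Coins affect only the \<open>A_of\<close> field, which the updates of the other two
  fields never read.\<close>

lemma fold_rog_edge_coins_irrelevant:
  assumes "S_of s = S_of s'" "B_of s = B_of s'"
  shows "S_of (fold (rog_edge C w v t) Ms s) = S_of (fold (rog_edge C w v' t) Ms s') \<and>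
         B_of (fold (rog_edge C w v t) Ms s) = B_of (fold (rog_edge C w v' t) Ms s')"
  using assms
proof (induction Ms arbitrary: s s')
  case (Cons e Ms)
  show ?case
    unfolding fold_simps
    by (rule Cons.IH) (use Cons.prems in \<open>auto simp: rog_edge_def Let_def\<close>)
qed simp

lemma rog_run_coins_irrelevant:
  "S_of (rog_run n C w scan v t) = S_of (rog_run n C w scan v' t) \<and>
   B_of (rog_run n C w scan v t) = B_of (rog_run n C w scan v' t)"
proof (induction t)
  case (Suc t)
  then show ?case
    using fold_rog_edge_coins_irrelevant[of "rog_run n C w scan v t" "rog_run n C w scan v' t"]
    by (simp add: Let_def)
qed simp

text \<open>Confines the randomness to a filter applied to a set that is the same for all
  coins.\<close>

lemma A_of_rog_run:
  "A_of (rog_run n C w scan v t) i = {x \<in> B_of (rog_run n C w scan v t) i. keeps C w v x}"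
  by (induction t) (auto simp: Let_def A_of_fold_rog_edge B_of_fold_rog_edge)

lemma B_of_rog_run_subset:
  assumes "\<And>t. t \<in> {1..T} \<Longrightarrow> set (scan t) = E t" "t \<le> T"
  shows "B_of (rog_run n C w scan v t) i \<subseteq> {x \<in> Sigma {1..t} E. fst (snd x) = i}"
  using assms(2)
proof (induction t)
  case (Suc t)
  have "set (greedy (scan (Suc t)) S) \<subseteq> E (Suc t)" for S
    using set_greedy_subset assms(1)[of "Suc t"] Suc.prems by fastforce
  with Suc show ?case
    by (fastforce simp: Let_def B_of_fold_rog_edge)
qed simp

lemma rog_run_removed_heavy:
  assumes E: "\<And>t. t \<in> {1..T} \<Longrightarrow> set (scan t) = E t"
    and nonneg: "\<And>t e. t \<in> {1..T} \<Longrightarrow> e \<in> E t \<Longrightarrow> 0 \<le> w t e"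
    and "t \<le> T" "i \<in> {1..n}" "i \<notin> S_of (rog_run n C w scan v t)"
  shows "C i / 2 < weight w (B_of (rog_run n C w scan v t) i)"
  using assms(3,5)
proof (induction t)
  case (Suc t)
  let ?s = "rog_run n C w scan v t"
  let ?M = "greedy (scan (Suc t)) (S_of ?s)"
  have finE: "finite (E t)" if "t \<in> {1..T}" for t
    using E[OF that] by (metis List.finite_set)
  have sub: "B_of (rog_run n C w scan v t') i \<subseteq> Sigma {1..T} E" if "t' \<le> T" for t'
    using B_of_rog_run_subset[of T scan E t' n C w v i] E that by fastforce
  have fin: "finite (B_of (rog_run n C w scan v t') i)" if "t' \<le> T" for t'
    using sub[OF that] finE by (meson finite_SigmaI finite_atLeastAtMost finite_subset)
  show ?case
  \<comment> \<open>Either \<open>i\<close> is removed during this very step, or it was removed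
    earlier and its set has only grown.\<close>
  proof (cases "i \<in> S_of ?s")
    case True
    have "e \<in> E (Suc t)" if "e \<in> set ?M" for e
      using that set_greedy_subset E[of "Suc t"] Suc.prems(1) by fastforce
    then have "C i / 2 < weight w (B_of (fold (rog_edge C w v (Suc t)) ?M ?s) i)"
      using True Suc.prems sub[of t] fin[of t] nonneg
      by (intro removed_fold_rog_edge) (auto simp: Let_def)
    then show ?thesis by (simp add: Let_def)
  next
    case False
    then have "C i / 2 < weight w (B_of ?s i)"
      using Suc by simp
    also have "\<dots> \<le> weight w (B_of (rog_run n C w scan v (Suc t)) i)"
      by (rule weight_mono)
        (use fin[OF Suc.prems(1)] sub[OF Suc.prems(1)] nonneg in
          \<open>auto simp: Let_def B_of_fold_rog_edge\<close>)
    finally show ?thesis .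
  qed
qed (use assms in simp)

text \<open>\<open>S\<close> only shrinks, so a server present after step \<open>t\<close> was
  available to the greedy run of every step \<open>t'\<close> up to \<open>t\<close>. The witness
  may belong to another server, hence the index \<open>fst e'\<close>.\<close>

lemma rog_run_blocks:
  assumes "\<And>t. t \<in> {1..T} \<Longrightarrow> scan_order (w t) (E t) (scan t)"
    and "t \<le> T" "t' \<in> {1..t}" "e \<in> E t'" "fst e \<in> S_of (rog_run n C w scan v t)"
  shows "\<exists>e'. (t', e') \<in> B_of (rog_run n C w scan v t) (fst e') \<and> w t' e \<le> w t' e' \<and>
           (fst e' = fst e \<or> snd e' = snd e)"
  using assms(2,3,5)
proof (induction t)
  case (Suc t)
  let ?s = "rog_run n C w scan v t"
  have S: "fst e \<in> S_of ?s"
    using Suc.prems(3) S_of_fold_rog_edge_subset by (fastforce simp: Let_def)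
  show ?case
  proof (cases "t' = Suc t")
    case True
    have "scan_order (w t') (E t') (scan t')"
      using assms(1) True Suc.prems by simp
    then obtain e' where "e' \<in> set (greedy (scan t') (S_of ?s))" "w t' e \<le> w t' e'"
      "fst e' = fst e \<or> snd e' = snd e"
      using greedy_blocks[of "w t'" "scan t'" e "S_of ?s"] S assms(4)
      unfolding scan_order_def by blast
    then show ?thesis
      using True by (intro exI[of _ e']) (auto simp: Let_def B_of_fold_rog_edge)
  next
    case False
    then show ?thesis
      using Suc.IH Suc.prems S by (fastforce simp: Let_def B_of_fold_rog_edge)
  qed
qed simp

section \<open>Coin flips and expectation\<close>

lemma prob_keeps:
  assumes "fst (snd x) \<in> {1..n}"
  shows "measure_pmf.prob (coins n) {v. keeps C w v x} = 1 / 2"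
proof -
  obtain t e where x: "x = (t, e)" by (cases x)
  \<comment> \<open>\<open>b\<close> is the value that the coin of the edge's server must show; the
    marginal of that coin is fair.\<close>
  define b where "b \<longleftrightarrow> w t e > C (fst e) / 2"
  have "measure_pmf.prob (coins n) {v. keeps C w v x} =
      measure_pmf.prob (map_pmf (\<lambda>v. v (fst e)) (coins n)) {b}"
    by (simp add: x keeps_def b_def measure_map_pmf vimage_def)
  also have "map_pmf (\<lambda>v. v (fst e)) (coins n) = bernoulli_pmf (1/2)"
    using assms by (simp add: coins_def Pi_pmf_component x)
  also have "measure_pmf.prob (bernoulli_pmf (1/2)) {b} = 1 / 2"
    by (cases b) (simp_all add: measure_pmf_single)
  finally show ?thesis .
qed

text \<open>Linearity of expectation: the kept weight is a sum of indicators scaled by edge weights,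
  each of probability one half.\<close>

lemma expectation_weight_kept:
  assumes "finite B" "\<And>x. x \<in> B \<Longrightarrow> fst (snd x) \<in> {1..n}"
  shows "measure_pmf.expectation (coins n) (\<lambda>v. weight w {x \<in> B. keeps C w v x}) = weight w B / 2"
proof -
  have "weight w {x \<in> B. keeps C w v x} =
      (\<Sum>x\<in>B. w (fst x) (snd x) * indicator {v. keeps C w v x} v)" for v
    unfolding weight_def sum.inter_filter[OF assms(1)]
    by (intro sum.cong) (auto simp: indicator_def)
  then have "measure_pmf.expectation (coins n) (\<lambda>v. weight w {x \<in> B. keeps C w v x}) =
      (\<Sum>x\<in>B. w (fst x) (snd x) * measure_pmf.prob (coins n) {v. keeps C w v x})"
    by (simp, subst Bochner_Integration.integral_sum)
      (auto intro!: integrable_mult_right integrable_real_indicator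
        simp: measure_pmf.emeasure_eq_measure)
  also have "\<dots> = (\<Sum>x\<in>B. w (fst x) (snd x) / 2)"
    using assms(2) by (simp add: prob_keeps)
  finally show ?thesis
    by (simp add: weight_def case_prod_beta sum_divide_distrib)
qed

section \<open>The optimum and the competitive ratio\<close>

text \<open>A bound on every feasible set passes to \<open>Max\<close> once the set of attained
  weights is known to be finite and nonempty; the empty set is feasible since capacities are
  positive.\<close>

lemma OPT_le:
  assumes inst: "obrm_instance n C T J E w"
    and bound: "\<And>F. feasible n C T E w F \<Longrightarrow> finite F \<Longrightarrow> weight w F \<le> c"
  shows "OPT n C T E w \<le> c"
proof -
  have "finite (E t)" if "t \<in> {1..T}" for t
    using inst that unfolding obrm_instance_def
    by (meson finite_SigmaI finite_atLeastAtMost finite_subset)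
  then have fin: "finite (Sigma {1..T} E)" by blast
  have sub: "F \<subseteq> Sigma {1..T} E" if "feasible n C T E w F" for F
    using that by (simp add: feasible_def)
  have "{weight w F |F. feasible n C T E w F} \<subseteq> weight w ` Pow (Sigma {1..T} E)"
    using sub by blast
  then have "finite {weight w F |F. feasible n C T E w F}"
    using fin by (meson finite_Pow_iff finite_imageI finite_subset)
  moreover have "feasible n C T E w {}"
    using inst by (auto simp: feasible_def matching_def weight_def obrm_instance_def
        intro: less_imp_le)
  moreover have "weight w F \<le> c" if "feasible n C T E w F" for F
    using bound[OF that] sub[OF that] fin finite_subset by blast
  ultimately show ?thesis
    unfolding OPT_def by (intro Max.boundedI) auto
qed

theorem theorem2:
  fixes n T :: nat
    and C :: "nat \<Rightarrow> real"
    and J :: "nat \<Rightarrow> 'j set"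
    and E :: "nat \<Rightarrow> 'j edge set"
    and w :: "nat \<Rightarrow> 'j edge \<Rightarrow> real"
    and scan :: "nat \<Rightarrow> 'j edge list"
  assumes "obrm_instance n C T J E w"
    and "\<And>t i j. t \<in> {1..T} \<Longrightarrow> (i, j) \<in> E t \<Longrightarrow> w t (i, j) \<le> C i"
    and "\<And>t. t \<in> {1..T} \<Longrightarrow> scan_order (w t) (E t) (scan t)"
  shows "measure_pmf.expectation (coins n) (\<lambda>v. weight w (rog_output n C T w scan v))
           \<ge> 1 / 6 * OPT n C T E w"
proof -
  \<comment> \<open>Any coin vector would do here, as only \<open>S_of\<close> and
    \<open>B_of\<close> of this state are used.\<close>
  define s where "s = rog_run n C w scan (\<lambda>_. False) T"
  define B where "B = (\<Union>i\<in>{1..n}. B_of s i)"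
  define R where "R = {1..n} - S_of s"
  have scan: "set (scan t) = E t" if "t \<in> {1..T}" for t
    using assms(3)[OF that] by (simp add: scan_order_def)
  have E: "E t \<subseteq> {1..n} \<times> UNIV" if "t \<in> {1..T}" for t
    using assms(1) that by (fastforce simp: obrm_instance_def)
  have nonneg: "0 \<le> w t e" if "t \<in> {1..T}" "e \<in> E t" for t e
    using assms(1) that by (simp add: obrm_instance_def)
  have finE: "finite (Sigma {1..T} E)"
    using scan by (metis List.finite_set finite_SigmaI finite_atLeastAtMost)
  have B_i: "B_of s i \<subseteq> {x \<in> Sigma {1..T} E. fst (snd x) = i}" for i
    unfolding s_def by (rule B_of_rog_run_subset[of T]) (use scan in auto)
  then have subB: "B \<subseteq> Sigma {1..T} E"
    unfolding B_def by blast
  then have finB: "finite B"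
    using finE finite_subset by blast
  have B_at: "{x \<in> B. fst (snd x) = i} = B_of s i" if "i \<in> {1..n}" for i
    using B_i that unfolding B_def by blast
  have "rog_output n C T w scan v = {x \<in> B. keeps C w v x}" for v
    using rog_run_coins_irrelevant[of n C w scan v T "\<lambda>_. False"]
    by (auto simp: rog_output_def B_def s_def A_of_rog_run)
  moreover have "fst (snd x) \<in> {1..n}" if "x \<in> B" for x
    using that B_i unfolding B_def by blast
  ultimately have "measure_pmf.expectation (coins n) (\<lambda>v. weight w (rog_output n C T w scan v)) =
      weight w B / 2"
    using expectation_weight_kept[OF finB] by simp
  moreover have "OPT n C T E w \<le> 3 * weight w B"
  proof (rule OPT_le[OF assms(1)])
    fix F assume F: "feasible n C T E w F" "finite F"
    show "weight w F \<le> 3 * weight w B"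
    proof (rule feasible_weight_le_triple[OF F E finB])
      show "C i \<le> 2 * weight w {x \<in> B. fst (snd x) = i}" if "i \<in> R" for i
        using rog_run_removed_heavy[of T scan E w T i n C "\<lambda>_. False"] scan nonneg that
        by (fastforce simp: R_def B_at s_def[symmetric])
      show "\<exists>e'. (t, e') \<in> B \<and> w t e \<le> w t e' \<and> (fst e' = fst e \<or> snd e' = snd e)"
        if "(t, e) \<in> F" "fst e \<notin> R" for t e
      proof -
        have te: "t \<in> {1..T}" "e \<in> E t"
          using F that by (auto simp: feasible_def)
        then have "fst e \<in> S_of s"
          using E that(2) by (fastforce simp: R_def)
        then obtain e' where e': "(t, e') \<in> B_of s (fst e')" "w t e \<le> w t e'"
          "fst e' = fst e \<or> snd e' = snd e"
          using rog_run_blocks[of T w E scan T t e n C "\<lambda>_. False"] assms(3) te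
          unfolding s_def by blast
        \<comment> \<open>Being an edge of the instance places the server of \<open>e'\<close> in
          \<open>{1..n}\<close>, the index range of the union \<open>B\<close>.\<close>
        then have "e' \<in> E t"
          using B_i by blast
        then have "fst e' \<in> {1..n}"
          using E te by fastforce
        with e' show ?thesis
          unfolding B_def by blast
      qed
    qed (use subB nonneg in \<open>auto simp: R_def\<close>)
  qed
  \<comment> \<open>The factor 1/6 is the 1/2 from the coins times the 1/3 from the
    charging.\<close>
  ultimately show ?thesis by simp
qed

end
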